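(* Let $D$ be a digraph on $n$ vertices with $c(D)\ge 5$, and let $k$ be an integer with $2\le k\le n-3$. Let $r=2$ if $k=2$, and $r=\min\{\max\{k,n-k\},\,c(D)-3\}$ otherwise. Then $c(F_k(D))\ge r\,c(D)$.
   Context: A digraph $D$ has a finite vertex set $V(D)$ and a set $A(D)$ of arcs, which are ordered pairs of distinct vertices (both $(x,y)$ and $(y,x)$ may be arcs). For a digraph $D$ of order $n$ and $1 \le k \le n-1$, the $k$-token digraph $F_k(D)$ has as vertices all $k$-subsets of $V(D)$, and $(A,B)$ is an arc of $F_k(D)$ whenever $A\setminus B=\{a\}$, $B\setminus A=\{b\}$ and $(a,b)\in A(D)$. An oriented cycle is a directed cycle without repeated vertices (other than the first and last); length $2$ is allowed. The oriented circumference $c(D)$ is the length of a longest oriented cycle in $D$. *)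

theory Defs
  imports "Graph_Theory.Graph_Theory"
begin

definition token_digraph :: "nat \<Rightarrow> 'a pair_pre_digraph \<Rightarrow> 'a set pair_pre_digraph" where
  "token_digraph k D = \<lparr>
     pverts = {A. A \<subseteq> pverts D \<and> card A = k},
     parcs = {(A, B). A \<subseteq> pverts D \<and> card A = k \<and> B \<subseteq> pverts D \<and> card B = k \<and>
                (\<exists>a b. A - B = {a} \<and> B - A = {b} \<and> (a, b) \<in> parcs D)} \<rparr>"

(* The library's cycle allows length 2, and length 1 only at a loop, so in a loopfree
   digraph it is exactly an oriented cycle.  Sup on nat is Max for a finite nonempty set
   and 0 for the empty set, so an acyclic digraph gets the value 0.  For a finite digraph
   the set of cycle lengths is finite, see finite_cycle_lengths below. *)
definition oriented_circumference :: "('a, 'b) pre_digraph \<Rightarrow> nat" where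
  "oriented_circumference G = Sup (length ` {p. pre_digraph.cycle G p})"

lemma pair_digraph_token_digraph:
  assumes "pair_digraph D"
  shows "pair_digraph (token_digraph k D)"
proof -
  interpret D: pair_digraph D by (rule assms)
  have verts: "pverts (token_digraph k D) = {A. A \<subseteq> pverts D \<and> card A = k}"
    by (simp add: token_digraph_def)
  have arcD: "fst e \<in> pverts (token_digraph k D) \<and> snd e \<in> pverts (token_digraph k D) \<and> fst e \<noteq> snd e"
    if "e \<in> parcs (token_digraph k D)" for e
  proof (cases e)
    case (Pair A B)
    with that obtain a where "A \<subseteq> pverts D" "card A = k" "B \<subseteq> pverts D" "card B = k" "A - B = {a}"
      unfolding token_digraph_def by force
    moreover from this have "A \<noteq> B" by blast
    ultimately show ?thesis using Pair verts by simp
  qed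
  have fin: "finite (pverts (token_digraph k D))"
    using D.pair_finite_verts verts by simp
  moreover have "finite (parcs (token_digraph k D))"
  proof (rule finite_subset[OF _ finite_cartesian_product[OF fin fin]])
    show "parcs (token_digraph k D) \<subseteq> pverts (token_digraph k D) \<times> pverts (token_digraph k D)"
      using arcD by (metis mem_Times_iff subsetI)
  qed
  ultimately show ?thesis
    by unfold_locales (use arcD in blast)+
qed

lemma finite_cycle_lengths:
  assumes "fin_digraph G"
  shows "finite (length ` {p. pre_digraph.cycle G p})"
proof -
  interpret fin_digraph G by (rule assms)
  have "length p \<le> card (arcs G)" if "cycle p" for p
  proof -
    from that have "set p \<subseteq> arcs G" "distinct p"
      by (auto simp: cycle_conv awalk_def)
    then show ?thesis
      by (metis card_mono distinct_card finite_arcs)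
  qed
  then have "length ` {p. cycle p} \<subseteq> {..card (arcs G)}"
    by auto
  then show ?thesis
    by (rule finite_subset) simp
qed

end

theory Submission
  imports Defs
begin

text \<open>
  Take a longest cycle \<open>v\<close> of \<open>D\<close>, of length \<open>c\<close>, and put \<open>j\<close> tokens on consecutive vertices
  of it, with \<open>1 \<le> j \<le> c - 3\<close>; any further tokens rest on vertices outside the cycle and never
  move. Let the block crawl along the cycle like a caterpillar: the front token steps forward,
  then the token behind it, and so on until the last one has moved and the whole block has
  advanced by one position. Repeating this \<open>c\<close> times takes \<open>j * c\<close> moves and returns to the
  start.

  No configuration is met twice. At any moment the tokens fill an interval of \<open>j + 1\<close> cycle
  positions with exactly one gap, and the gap is not at the rear position. The part of the cycle
  outside the interval has \<open>c - j - 1 \<ge> 2\<close> positions, whereas the gap is a single position (or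
  merges with that outer part, when it is at the front). So the rear is the only occupied
  position with two free positions right behind it; it can be read off from the
  configuration, and then the gap can be read off too (lemma \<open>gapped_block_position\<close>).
  This is where \<open>j \<le> c - 3\<close> enters.

  With \<open>k\<close> tokens, \<open>j = min k (c - 3)\<close> is possible: the \<open>k - j\<close> resting tokens
  find room since \<open>k \<le> n - 3\<close>. This settles \<open>k = 2\<close> and \<open>k \<ge> n - k\<close>. Otherwise look at the
  holes instead of the tokens: when a token moves along an arc, a hole moves along the reversed
  arc, so complementation carries cycles of the \<open>(n - k)\<close>-token digraph of the reversal of \<open>D\<close>
  to cycles of the \<open>k\<close>-token digraph of \<open>D\<close>. The reversal has a cycle of length \<open>c\<close> as well,
  so the construction with \<open>n - k\<close> tokens applies. It needs \<open>n - k \<le> n - 3\<close>, that is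
  \<open>k \<ge> 3\<close>, which is why \<open>k = 2\<close> is treated apart.
\<close>

section \<open>Cycles as periodic vertex sequences\<close>

text \<open>
  Indexing a cycle by all integers, with indices read modulo \<open>L\<close>, avoids a special case
  at the closing arc, lets positions behind a vertex be written by subtraction, and turns reversal
  into negation of the index.
\<close>

definition periodic_cycle :: "'a rel \<Rightarrow> nat \<Rightarrow> (int \<Rightarrow> 'a) \<Rightarrow> bool" where
  "periodic_cycle E L v \<longleftrightarrow>
     (\<forall>i. (v i, v (i + 1)) \<in> E) \<and> (\<forall>i j. v i = v j \<longleftrightarrow> int L dvd i - j)"

lemma periodic_cycle_arc: "periodic_cycle E L v \<Longrightarrow> (v i, v (i + 1)) \<in> E"
  by (simp add: periodic_cycle_def)

lemma periodic_cycle_eq_iff: "periodic_cycle E L v \<Longrightarrow> v i = v j \<longleftrightarrow> int L dvd i - j"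
  by (simp add: periodic_cycle_def)

lemma periodic_cycle_inj_on:
  assumes "periodic_cycle E L v"
  shows "inj_on v {i..<i + int L}"
proof (rule inj_onI)
  fix x y assume "x \<in> {i..<i + int L}" "y \<in> {i..<i + int L}" "v x = v y"
  then have "\<bar>x - y\<bar> < int L" "int L dvd x - y"
    using periodic_cycle_eq_iff[OF assms] by auto
  then show "x = y"
    using dvd_imp_le_int[of "x - y" "int L"] by force
qed

lemma card_range_periodic_cycle:
  assumes "periodic_cycle E L v" "L > 0"
  shows "card (range v) = L"
proof -
  have "v i \<in> v ` {0..<int L}" for i
  proof (rule image_eqI)
    show "v i = v (i mod int L)"
      using periodic_cycle_eq_iff[OF assms(1)] by (simp add: minus_mod_eq_mult_div)
    show "i mod int L \<in> {0..<int L}"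
      using assms(2) by simp
  qed
  then have "range v = v ` {0..<int L}"
    by blast
  then show ?thesis
    using card_image[OF periodic_cycle_inj_on[OF assms(1), of 0]] by simp
qed

lemma periodic_cycle_converse:
  assumes "periodic_cycle E L v"
  shows "periodic_cycle (E\<inverse>) L (\<lambda>i. v (- i))"
  unfolding periodic_cycle_def
proof (intro conjI allI)
  fix i j
  show "(v (- i), v (- (i + 1))) \<in> E\<inverse>"
    using periodic_cycle_arc[OF assms, of "- i - 1"] by simp
  have "int L dvd - i - - j \<longleftrightarrow> int L dvd i - j"
    using dvd_minus_iff[of "int L" "i - j"] by simp
  then show "v (- i) = v (- j) \<longleftrightarrow> int L dvd i - j"
    using periodic_cycle_eq_iff[OF assms] by simp
qed

lemma pcas_consecutive:
  assumes "pcas u p w" "Suc i < length p"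
  shows "fst (p ! Suc i) = snd (p ! i)"
  using assms
proof (induction p arbitrary: u i)
  case (Cons e p)
  then show ?case
    by (cases i; cases p) auto
qed simp

lemma pcas_hd: "pcas u p w \<Longrightarrow> p \<noteq> [] \<Longrightarrow> fst (hd p) = u"
  by (cases p) auto

lemma pcas_last: "pcas u p w \<Longrightarrow> p \<noteq> [] \<Longrightarrow> snd (last p) = w"
  by (induction p arbitrary: u) (auto split: if_splits)

lemma pcas_map_upt:
  "pcas (v i) (map (\<lambda>m. (v (i + int m), v (i + int m + 1))) [0..<L]) (v (i + int L))"
proof (induction L arbitrary: i)
  case (Suc L)
  show ?case
    using Suc[of "i + 1"] by (simp add: upt_conv_Cons map_Suc_upt[symmetric] o_def ac_simps del: upt_Suc)
qed simp

text \<open>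
  The sequence lists the heads of the arcs: these are the vertices \<open>tl (awalk_verts u p)\<close>
  that a cycle requires to be distinct.
\<close>

lemma periodic_cycle_of_cycle:
  fixes D :: "'a pair_pre_digraph"
  assumes "pair_wf_digraph D" and "pre_digraph.cycle (with_proj D) p"
  obtains v where "periodic_cycle (parcs D) (length p) v"
proof -
  interpret pair_wf_digraph D by (rule assms)
  obtain u where u: "awalk u p u" "distinct (tl (pawalk_verts u p))" "p \<noteq> []"
    using assms(2) unfolding cycle_def by blast
  have cas: "pcas u p u" and arcs: "set p \<subseteq> parcs D"
    using u(1) by (auto simp: awalk_def)
  have dist: "distinct (map snd p)"
    using u(2,3) awalk_verts_conv'[OF cas] by simp
  define L where "L = length p"
  have L: "L > 0" using u(3) by (simp add: L_def)
  define v where "v i = snd (p ! nat (i mod int L))" for i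
  have lt: "nat (i mod int L) < L" for i
    using L by (simp add: nat_less_iff)
  have "(v i, v (i + 1)) \<in> parcs D" for i
  proof -
    define m where "m = nat (i mod int L)"
    have m: "m < L" "int m = i mod int L" using lt L by (simp_all add: m_def)
    have e: "fst (p ! nat ((i + 1) mod int L)) = snd (p ! m)"
    proof (cases "Suc m < L")
      case True
      then have "(i + 1) mod int L = int (Suc m)"
        using m(2) mod_add_left_eq[of i "int L" 1] by simp
      then show ?thesis
        using pcas_consecutive[OF cas] True unfolding L_def by (metis nat_int)
    next
      case False
      then have "m = L - 1" using m(1) by simp
      moreover from this have "(i + 1) mod int L = 0"
        using m(2) mod_add_left_eq[of i "int L" 1] L by (metis Suc_pred' diff_add_cancel mod_self of_nat_1 of_nat_Suc add.commute One_nat_def)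
      ultimately show ?thesis
        using pcas_last[OF cas u(3)] pcas_hd[OF cas u(3)] u(3)
        by (simp add: last_conv_nth hd_conv_nth L_def)
    qed
    have "p ! nat ((i + 1) mod int L) \<in> parcs D"
      using arcs lt nth_mem unfolding L_def by blast
    then have "(snd (p ! m), snd (p ! nat ((i + 1) mod int L))) \<in> parcs D"
      using e by (metis prod.collapse)
    then show ?thesis unfolding v_def m_def .
  qed
  moreover have "v i = v j \<longleftrightarrow> int L dvd i - j" for i j
  proof -
    have "v i = v j \<longleftrightarrow> nat (i mod int L) = nat (j mod int L)"
      unfolding v_def using nth_eq_iff_index_eq[OF dist] lt by (simp add: L_def)
    also have "\<dots> \<longleftrightarrow> i mod int L = j mod int L"
      using L by (simp add: eq_nat_nat_iff)
    finally show ?thesis by (simp add: mod_eq_dvd_iff)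
  qed
  ultimately show thesis
    using that unfolding periodic_cycle_def L_def by blast
qed

lemma cycle_of_periodic_cycle:
  fixes D :: "'a pair_pre_digraph"
  assumes "pair_wf_digraph D" and v: "periodic_cycle (parcs D) L v" and "L > 0"
  obtains p where "pre_digraph.cycle (with_proj D) p" "length p = L"
proof -
  interpret pair_wf_digraph D by (rule assms)
  define p where "p = map (\<lambda>m. (v (0 + int m), v (0 + int m + 1))) [0..<L]"
  have "v (0 + int L) = v 0"
    using periodic_cycle_eq_iff[OF v] by simp
  then have cas: "pcas (v 0) p (v 0)"
    using pcas_map_upt[of v 0 L] by (simp add: p_def)
  have ne: "p \<noteq> []" using \<open>L > 0\<close> by (simp add: p_def)
  have "tl (pawalk_verts (v 0) p) = map (\<lambda>m. v (int m + 1)) [0..<L]"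
    using awalk_verts_conv'[OF cas] ne by (simp add: p_def o_def)
  moreover have "distinct \<dots>"
    using inj_onD[OF periodic_cycle_inj_on[OF v, of 1]] by (fastforce simp: distinct_map inj_on_def)
  moreover have "awalk (v 0) p (v 0)"
    using cas periodic_cycle_arc[OF v] in_arcsD1 by (auto simp: awalk_def p_def)
  ultimately have "cycle p"
    using ne unfolding cycle_def by metis
  then show thesis
    using that by (simp add: p_def)
qed

text \<open>
  The supremum is a maximum only if some cycle exists; positivity excludes the
  value \<open>Sup {} = 0\<close>.
\<close>

lemma circumference_attained:
  assumes "pair_digraph D" and "oriented_circumference (with_proj D) > 0"
  obtains v where "periodic_cycle (parcs D) (oriented_circumference (with_proj D)) v"
proof -
  interpret pair_digraph D by (rule assms)
  let ?S = "length ` {p. cycle p}"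
  have "?S \<noteq> {}"
  proof
    assume "?S = {}"
    then show False
      using assms(2) by (simp add: oriented_circumference_def Sup_nat_def del: image_is_empty)
  qed
  then have "oriented_circumference (with_proj D) \<in> ?S"
    using Max_in[OF finite_cycle_lengths[OF fin_digraph_axioms]]
    by (simp add: oriented_circumference_def cSup_eq_Max[OF finite_cycle_lengths[OF fin_digraph_axioms]])
  then show thesis
    using periodic_cycle_of_cycle[OF pair_wf_digraph_axioms] that by (metis imageE mem_Collect_eq)
qed

lemma periodic_cycle_le_circumference:
  assumes "pair_digraph D" and "periodic_cycle (parcs D) L v"
  shows "L \<le> oriented_circumference (with_proj D)"
proof (cases "L > 0")
  case True
  interpret pair_digraph D by (rule assms)
  obtain p where "cycle p" "length p = L"
    using cycle_of_periodic_cycle[OF pair_wf_digraph_axioms assms(2) True] .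
  then have "L \<in> length ` {p. cycle p}" by blast
  then show ?thesis
    unfolding oriented_circumference_def
    by (intro cSup_upper bdd_above_finite finite_cycle_lengths fin_digraph_axioms)
qed simp

section \<open>The caterpillar walk\<close>

text \<open>
  The configuration in which tokens fill the cycle positions \<open>i, \<dots>, i + j\<close> except for a gap
  at offset \<open>m\<close>, while the tokens on \<open>R\<close> rest off the cycle. One move of the caterpillar lowers
  \<open>m\<close> by one.
\<close>

definition gapped_block :: "(int \<Rightarrow> 'a) \<Rightarrow> int \<Rightarrow> 'a set \<Rightarrow> int \<Rightarrow> int \<Rightarrow> 'a set" where
  "gapped_block v j R i m = (\<lambda>y. v (i + y)) ` ({0..j} - {m}) \<union> R"

text \<open>
  When the gap has reached the rear, all tokens have moved once; the same set is the block
  one position further on, with its gap at the front.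
\<close>

lemma gapped_block_advance:
  "gapped_block v j R i 0 = gapped_block v j R (i + 1) j"
proof -
  have "{0..j} - {j} = {0..j - 1}" "{0..j} - {0} = {0 + 1..(j - 1) + 1}"
    by auto
  then have "(+) 1 ` ({0..j} - {j}) = {0..j} - {0}"
    by (simp only: image_add_atLeastAtMost add.commute)
  then have "(\<lambda>y. v (i + y)) ` ({0..j} - {0}) = (\<lambda>y. v (i + y)) ` (+) 1 ` ({0..j} - {j})"
    by simp
  then show ?thesis
    unfolding gapped_block_def by (simp add: image_image ac_simps)
qed

lemma mem_gapped_block:
  assumes "periodic_cycle E c v" "range v \<inter> R = {}"
  shows "v x \<in> gapped_block v j R i m \<longleftrightarrow> (\<exists>y\<in>{0..j} - {m}. int c dvd x - (i + y))"
  using assms periodic_cycle_eq_iff[OF assms(1), of x] by (auto simp: gapped_block_def)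

text \<open>
  A configuration determines the rear of its interval, up to a full turn, as the only
  occupied position whose two predecessors are free. The bound \<open>j + 3 \<le> c\<close> keeps both
  predecessors of the rear outside the interval, and \<open>1 \<le> m\<close> says that the rear is occupied.
\<close>

lemma gapped_block_position:
  assumes v: "periodic_cycle E c v" and R: "range v \<inter> R = {}"
    and c: "j + 3 \<le> int c" and m: "1 \<le> m" "m \<le> j" and m': "1 \<le> m'" "m' \<le> j"
    and eq: "gapped_block v j R i m = gapped_block v j R i' m'"
  shows "int c dvd i - i'" "m = m'"
proof -
  note mem = mem_gapped_block[OF v R]
  have small: "d = 0" if "int c dvd d" "\<bar>d\<bar> < int c" for d
    using that dvd_imp_le_int[of d "int c"] by force
  \<comment> \<open>In the second block \<open>i\<close> is at offset \<open>y\<close>. Its two predecessors are free, which is impossible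
    for \<open>y \<ge> 1\<close>, since one of the offsets \<open>y - 1\<close> and \<open>y - 2\<close> would be occupied.\<close>
  have "v i \<in> gapped_block v j R i' m'"
    using mem[of i j i m] m by (auto simp: eq intro!: bexI[of _ 0])
  then obtain y where y: "y \<in> {0..j} - {m'}" "int c dvd i - (i' + y)"
    using mem by blast
  have free: "v (i - s) \<notin> gapped_block v j R i' m'" if "s \<in> {1, 2}" for s
  proof
    assume "v (i - s) \<in> gapped_block v j R i' m'"
    then obtain z where z: "z \<in> {0..j}" "int c dvd (i - s) - (i + z)"
      unfolding eq[symmetric] mem by blast
    then have "int c dvd s + z"
      using dvd_minus_iff[of "int c" "s + z"] by (simp add: algebra_simps)
    with z small[of "s + z"] that c show False by auto
  qed
  have shift: "int c dvd (i - s) - (i' + (y - s))" for s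
    using y(2) by (simp add: algebra_simps)
  have "y = 0"
  proof (rule ccontr)
    assume "y \<noteq> 0"
    then have "y \<ge> 1" using y by simp
    show False
    proof (cases "y - 1 = m'")
      case False
      then show False
        using free[of 1] mem[of "i - 1" j i' m'] shift[of 1] \<open>y \<ge> 1\<close> y(1)
        by (auto dest: bspec[of _ _ "y - 1"])
    next
      case True
      then show False
        using free[of 2] mem[of "i - 2" j i' m'] shift[of 2] m' y(1)
        by (auto dest: bspec[of _ _ "y - 2"])
    qed
  qed
  then show dvd: "int c dvd i - i'" using y(2) by simp
  have "v (i + m) \<notin> gapped_block v j R i m"
  proof
    assume "v (i + m) \<in> gapped_block v j R i m"
    then obtain z where "z \<in> {0..j} - {m}" "int c dvd m - z"
      using mem by fastforce
    then have "z \<noteq> m" "int c dvd m - z" "\<bar>m - z\<bar> < int c"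
      using c m by auto
    with small[of "m - z"] show False by simp
  qed
  moreover have "v (i + m) \<in> gapped_block v j R i' m'" if "m \<noteq> m'"
    using mem[of "i + m" j i' m'] that m dvd by (auto intro!: bexI[of _ m])
  ultimately show "m = m'" using eq by auto
qed

lemma gapped_block_token_arc:
  assumes v: "periodic_cycle (parcs D) c v" and D: "pair_digraph D"
    and R: "range v \<inter> R = {}" "R \<subseteq> pverts D"
    and c: "j < c" and k: "card R + j = k" and m: "1 \<le> m" "m \<le> int j"
  shows "(gapped_block v j R i m, gapped_block v j R i (m - 1)) \<in> parcs (token_digraph k D)"
proof -
  interpret pair_digraph D by (rule D)
  have sub: "range v \<subseteq> pverts D"
    using periodic_cycle_arc[OF v] in_arcsD1 by blast
  have finR: "finite R" using R(2) pair_finite_verts finite_subset by blast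
  have inj: "inj_on (\<lambda>y. v (i + y)) {0..int j}"
  proof (rule inj_onI)
    fix x y assume "x \<in> {0..int j}" "y \<in> {0..int j}" "v (i + x) = v (i + y)"
    then show "x = y"
      using inj_onD[OF periodic_cycle_inj_on[OF v, of i], of "i + x" "i + y"] c by auto
  qed
  have verts: "gapped_block v j R i l \<subseteq> pverts D \<and> card (gapped_block v j R i l) = k"
    if "l \<in> {0..int j}" for l
  proof
    show "gapped_block v j R i l \<subseteq> pverts D"
      using sub R(2) by (auto simp: gapped_block_def)
    have "card ((\<lambda>y. v (i + y)) ` ({0..int j} - {l})) = j"
      using that inj by (subst card_image) (auto intro: inj_on_subset)
    moreover have "(\<lambda>y. v (i + y)) ` ({0..int j} - {l}) \<inter> R = {}"
      using R(1) by auto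
    ultimately show "card (gapped_block v j R i l) = k"
      using k finR by (simp add: gapped_block_def card_Un_disjoint)
  qed
  have diff: "gapped_block v j R i a - gapped_block v j R i b = {v (i + b)}"
    if "a \<in> {0..int j}" "b \<in> {0..int j}" "a \<noteq> b" for a b
    using that R(1) inj_onD[OF inj] unfolding gapped_block_def by blast
  have "(v (i + (m - 1)), v (i + m)) \<in> parcs D"
    using periodic_cycle_arc[OF v, of "i + (m - 1)"] by (simp add: algebra_simps)
  then show ?thesis
    using verts[of m] verts[of "m - 1"] diff[of m "m - 1"] diff[of "m - 1" m] m
    unfolding token_digraph_def by auto
qed

text \<open>
  At time \<open>t\<close> the block has completed \<open>t div j\<close> advances and \<open>t mod j\<close> tokens have moved since
  the last one, so the gap sits at offset \<open>j - t mod j\<close>, which runs through \<open>j, \<dots>, 1\<close>.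
\<close>

lemma caterpillar_cycle:
  assumes v: "periodic_cycle (parcs D) c v" and D: "pair_digraph D"
    and R: "range v \<inter> R = {}" "R \<subseteq> pverts D"
    and j: "0 < j" "j + 3 \<le> c" and k: "card R + j = k"
  shows "periodic_cycle (parcs (token_digraph k D)) (j * c)
           (\<lambda>t. gapped_block v j R (t div int j) (int j - t mod int j))"
  unfolding periodic_cycle_def
proof (intro conjI allI)
  let ?W = "\<lambda>t. gapped_block v j R (t div int j) (int j - t mod int j)"
  have offset: "1 \<le> int j - t mod int j" "int j - t mod int j \<le> int j" for t
    using j(1) pos_mod_bound[of "int j" t] pos_mod_sign[of "int j" t] by linarith+
  fix t t'
  have "?W (t + 1) = gapped_block v j R (t div int j) (int j - t mod int j - 1)"
  proof (cases "t mod int j + 1 = int j")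
    case True
    have "t + 1 = (t div int j + 1) * int j"
      using True div_mult_mod_eq[of t "int j"] unfolding distrib_right by linarith
    then have "(t + 1) div int j = t div int j + 1" "(t + 1) mod int j = 0"
      using j(1) by simp_all
    then show ?thesis
      using True gapped_block_advance[of v "int j" R "t div int j"] by (simp add: algebra_simps)
  next
    case False
    then have s: "t mod int j + 1 < int j" "0 \<le> t mod int j + 1"
      using j(1) pos_mod_bound[of "int j" t] pos_mod_sign[of "int j" t] by linarith+
    have "t + 1 = t div int j * int j + (t mod int j + 1)"
      by simp
    then have "(t + 1) div int j = t div int j" "(t + 1) mod int j = t mod int j + 1"
      using s by (metis int_div_pos_eq mult.commute, metis int_mod_pos_eq mult.commute)
    then show ?thesis by (simp add: algebra_simps)
  qed
  then show "(?W t, ?W (t + 1)) \<in> parcs (token_digraph k D)"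
    using gapped_block_token_arc[OF v D R _ k offset, of "t div int j" t] j(2) by simp
  show "?W t = ?W t' \<longleftrightarrow> int (j * c) dvd t - t'"
  proof
    assume "?W t = ?W t'"
    then have "int c dvd t div int j - t' div int j"
      and "int j - t mod int j = int j - t' mod int j"
      using gapped_block_position[OF v R(1) _ offset offset] j(2) by simp_all
    moreover from this have "t - t' = int j * (t div int j - t' div int j)"
      using mult_div_mod_eq[of "int j" t] mult_div_mod_eq[of "int j" t']
      unfolding right_diff_distrib by linarith
    ultimately show "int (j * c) dvd t - t'"
      by simp
  next
    assume "int (j * c) dvd t - t'"
    then obtain q where "t - t' = int (j * c) * q" ..
    then have "t = t' + int j * (int c * q)" by (simp add: algebra_simps)
    then have "t div int j = t' div int j + int c * q" "t mod int j = t' mod int j"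
      using j(1) by simp_all
    moreover have "v (t' div int j + int c * q + y) = v (t' div int j + y)" for y
      using periodic_cycle_eq_iff[OF v] by simp
    ultimately show "?W t = ?W t'" by (simp add: gapped_block_def)
  qed
qed

text \<open>
  If \<open>k > c - 3\<close>, then \<open>k - (c - 3)\<close> tokens have to rest off the cycle, and \<open>k + 3 \<le> n\<close>
  says exactly that the \<open>n - c\<close> vertices there can hold them.
\<close>

lemma token_digraph_periodic_cycle:
  assumes D: "pair_digraph D" and v: "periodic_cycle (parcs D) c v" and "c \<ge> 4"
    and k: "1 \<le> k" "k + 3 \<le> card (pverts D)"
  obtains W where "periodic_cycle (parcs (token_digraph k D)) (min k (c - 3) * c) W"
proof -
  interpret pair_digraph D by (rule D)
  let ?j = "min k (c - 3)"
  have sub: "range v \<subseteq> pverts D"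
    using periodic_cycle_arc[OF v] in_arcsD1 by blast
  have card: "card (range v) = c"
    using card_range_periodic_cycle[OF v] \<open>c \<ge> 4\<close> by simp
  have "card (pverts D - range v) = card (pverts D) - c"
    using sub card pair_finite_verts card_Diff_subset finite_subset by metis
  moreover have "c \<le> card (pverts D)"
    using sub card pair_finite_verts card_mono by metis
  ultimately have "k - ?j \<le> card (pverts D - range v)"
    using k by auto
  then obtain R where "R \<subseteq> pverts D - range v" "card R = k - ?j"
    using obtain_subset_with_card_n by metis
  then have "periodic_cycle (parcs (token_digraph k D)) (?j * c)
      (\<lambda>t. gapped_block v ?j R (t div int ?j) (int ?j - t mod int ?j))"
    using k \<open>c \<ge> 4\<close> by (intro caterpillar_cycle[OF v D]) auto
  then show thesis by (rule that)
qed

section \<open>Tokens versus holes\<close>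

text \<open>
  A token moving from \<open>a\<close> to \<open>b\<close> is a hole moving from \<open>b\<close> to \<open>a\<close>.
\<close>

lemma periodic_cycle_complement:
  assumes fin: "finite (pverts D)" and k: "k \<le> card (pverts D)"
    and W: "periodic_cycle
      (parcs (token_digraph (card (pverts D) - k) \<lparr>pverts = pverts D, parcs = (parcs D)\<inverse>\<rparr>)) L W"
  shows "periodic_cycle (parcs (token_digraph k D)) L (\<lambda>i. pverts D - W i)"
  unfolding periodic_cycle_def
proof (intro conjI allI)
  have W_verts: "W i \<subseteq> pverts D" "card (W i) = card (pverts D) - k" for i
    using periodic_cycle_arc[OF W, of i] by (auto simp: token_digraph_def)
  have card: "card (pverts D - W i) = k" for i
    using W_verts[of i] k fin card_Diff_subset[of "W i" "pverts D"] finite_subset by fastforce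
  fix i j
  obtain a b where ab: "W i - W (i + 1) = {a}" "W (i + 1) - W i = {b}" "(b, a) \<in> parcs D"
    using periodic_cycle_arc[OF W, of i] by (auto simp: token_digraph_def)
  have "(pverts D - W i) - (pverts D - W (i + 1)) = {b}"
    "(pverts D - W (i + 1)) - (pverts D - W i) = {a}"
    using ab(1,2) W_verts(1)[of i] W_verts(1)[of "i + 1"] by blast+
  then show "(pverts D - W i, pverts D - W (i + 1)) \<in> parcs (token_digraph k D)"
    using card[of i] card[of "i + 1"] ab(3) by (simp add: token_digraph_def)
  show "pverts D - W i = pverts D - W j \<longleftrightarrow> int L dvd i - j"
    using W_verts(1)[of i] W_verts(1)[of j] periodic_cycle_eq_iff[OF W, of i j] by blast
qed

theorem theorem6p2:
  fixes D :: "'a pair_pre_digraph" and n k r :: nat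
  assumes "pair_digraph D"
    and "card (pverts D) = n"
    and "oriented_circumference (with_proj D) \<ge> 5"
    and "2 \<le> k" and "k \<le> n - 3"
    and "r = (if k = 2 then 2
              else min (max k (n - k)) (oriented_circumference (with_proj D) - 3))"
  shows "oriented_circumference (with_proj (token_digraph k D))
           \<ge> r * oriented_circumference (with_proj D)"
proof -
  interpret pair_digraph D by (rule assms(1))
  define c where "c = oriented_circumference (with_proj D)"
  have c: "c \<ge> 5" using assms(3) by (simp add: c_def)
  obtain v where v: "periodic_cycle (parcs D) c v"
    using circumference_attained[OF assms(1)] c unfolding c_def by auto
  have k_le: "k + 3 \<le> card (pverts D)"
    using assms(2,4,5) by linarith
  have "\<exists>W. periodic_cycle (parcs (token_digraph k D)) (r * c) W"
  proof (cases "k = 2 \<or> n - k \<le> k")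
    case True
    then have "r = min k (c - 3)"
      using assms(6) c by (auto simp: c_def)
    moreover obtain W where "periodic_cycle (parcs (token_digraph k D)) (min k (c - 3) * c) W"
      using token_digraph_periodic_cycle[OF assms(1) v _ _ k_le] c assms(4) by auto
    ultimately show ?thesis by blast
  next
    case False
    then have r: "r = min (n - k) (c - 3)"
      using assms(6) by (auto simp: c_def)
    let ?D' = "\<lparr>pverts = pverts D, parcs = (parcs D)\<inverse>\<rparr>"
    have "pair_digraph ?D'"
      using in_arcsD1 in_arcsD2 pair_no_loops pair_finite_verts pair_finite_arcs
      by unfold_locales fastforce+
    moreover have "periodic_cycle (parcs ?D') c (\<lambda>i. v (- i))"
      using periodic_cycle_converse[OF v] by simp
    moreover have "1 \<le> n - k" "n - k + 3 \<le> card (pverts ?D')"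
      using False assms(2,4) k_le by auto
    ultimately obtain W where
      "periodic_cycle (parcs (token_digraph (n - k) ?D')) (r * c) W"
      using token_digraph_periodic_cycle[of ?D' c "\<lambda>i. v (- i)" "n - k"] c
      unfolding r by auto
    then show ?thesis
      using periodic_cycle_complement[OF pair_finite_verts, of k] assms(2) k_le by auto
  qed
  then show ?thesis
    using periodic_cycle_le_circumference[OF pair_digraph_token_digraph[OF assms(1)]]
    unfolding c_def by blast
qed

end
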